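(* Let $k\ge3$ and let $$W(x_1,x_2,J,h)=\sum_{i=0}^{k}J^{i}\,h^{\,i\bmod 2}\,\frac{x_1^{i}x_2^{k-i}}{i!\,(k-i)!}.$$ Then for every integer $n\ge0$ the polynomial $A_n^W$ satisfies $$A_n^W(h,J)=\sum_{\substack{G\ k\text{-regular}\\ \chi(G)=-n}}\frac{1}{|\mathrm{Aut}(G)|}\sum_{\gamma\subseteq G}\ \prod_{v\in V_G}J^{\deg_\gamma(v)}\,h^{\deg_\gamma(v)\bmod 2}.$$ For the purpose of the automorphism group, $G$ is considered monocoloured.
   Context: **Graphs.** Graphs are finite, self-loops and multiple edges are allowed, and graphs need not be connected. Given disjoint finite sets $H_1,\dots,H_d$ of half-edge labels, a half-edge labelled $d$-coloured graph $\Gamma=(V,E_{H_1},\dots,E_{H_d})$ consists of a set partition $V$ of $H_1\sqcup\dots\sqcup H_d$ (vertices) and, for each $i$, a set partition $E_{H_i}$ of $H_i$ into blocks of size two (edges of colour $i$). An isomorphism is a tuple of bijections $j_i:H_i\to H'_i$ mapping $E_{H_i}$ to $E'_{H'_i}$ for each $i$ and, jointly, mapping $V$ to $V'$. An edge-coloured graph is an isomorphism class; $|\mathrm{Aut}|$ denotes the number of automorphisms of a representative. A monocoloured graph is the case $d=1$. $V_G,E_G$ are the sets of vertices and edges, and $\chi(G)=|V_G|-|E_G|$. The degree of a vertex $v$ is $\deg(v)=(|v\cap H_1|,\dots,|v\cap H_d|)$. **The polynomial.** For a polynomial $V(\boldsymbol{x})=\sum_{\boldsymbol{w}}\Lambda_{\boldsymbol{w}}\frac{\boldsymbol{x}^{\boldsymbol{w}}}{\boldsymbol{w}!}$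 in $x_1,\dots,x_d$ whose coefficients $\Lambda_{\boldsymbol{w}}$ are polynomials in some parameters ($\boldsymbol{w}!=w_1!\cdots w_d!$), set $A_n^V=\sum_{G\in\mathcal{G}_{-n}}\frac{1}{|\mathrm{Aut}(G)|}\prod_{v\in V_G}\Lambda_{\deg(v)}$, where $\mathcal{G}_{-n}$ is the set of isomorphism classes of $d$-edge-coloured graphs with Euler characteristic $-n$. Here $d=2$, $V=W$, with parameters $J,h$. **Right-hand side.** The outer sum is over isomorphism classes of monocoloured $k$-regular graphs $G$ with $\chi(G)=-n$. The inner sum is over all subgraphs $\gamma\subseteq G$, i.e. over all subsets of edges of (a representative of) $G$. $\deg_\gamma(v)$ is the number of half-edges in $\gamma$ incident to $v$. The exponent $i\bmod2$ is $0$ or $1$. *)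

theory Defs
  imports
    Complex_Main
    "HOL-Library.FuncSet"
    "HOL-Library.Disjoint_Sets"
    "HOL-Library.Numeral_Type"
    "HOL-Library.Poly_Mapping"
begin

section \<open>Multivariate polynomials\<close>

text \<open>Polynomials with coefficients in \<open>'r\<close>, with variables indexed by \<open>'v\<close>: an
  element of \<open>'v \<Rightarrow>\<^sub>0 nat\<close> is the exponent vector of a monomial.\<close>

type_synonym ('v, 'r) mpol = "('v \<Rightarrow>\<^sub>0 nat) \<Rightarrow>\<^sub>0 'r"

definition Const :: "'r::zero \<Rightarrow> ('v, 'r) mpol" where
  "Const c = Poly_Mapping.single 0 c"

definition Var :: "'v \<Rightarrow> ('v, 'r::zero_neq_one) mpol" where
  "Var i = Poly_Mapping.single (Poly_Mapping.single i 1) 1"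


section \<open>Edge-coloured graphs\<close>

text \<open>A half-edge labelled graph with set of colours the finite type \<open>'c\<close>; a
  \<open>d\<close>-coloured graph is the case of the numeral type \<open>d\<close>. The set of half-edges of
  colour \<open>i\<close> is not a separate component, since it is the union of the blocks of the
  partition \<open>edges G i\<close>.\<close>

datatype ('h, 'c) ecgraph =
  ECGraph (verts: "'h set set") (edges: "'c \<Rightarrow> 'h set set")

definition halfedges :: "('h, 'c) ecgraph \<Rightarrow> 'c \<Rightarrow> 'h set" where
  "halfedges G i = \<Union>(edges G i)"

definition ec_graph :: "('h, 'c::finite) ecgraph \<Rightarrow> bool" where
  "ec_graph G \<longleftrightarrow>
     (\<forall>i. finite (halfedges G i)) \<and>
     disjoint_family (halfedges G) \<and>
     partition_on (\<Union>i. halfedges G i) (verts G) \<and>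
     (\<forall>i. partition_on (halfedges G i) (edges G i) \<and> (\<forall>e\<in>edges G i. card e = 2))"

text \<open>Isomorphisms are tuples of bijections between finite sets. The maps are taken
  to be \<open>undefined\<close> off the half-edge sets, so that distinct elements of \<open>isos\<close> are
  distinct tuples and \<open>isos\<close> can be counted.\<close>

definition isos :: "('h, 'c::finite) ecgraph \<Rightarrow> ('h, 'c) ecgraph \<Rightarrow> ('c \<Rightarrow> 'h \<Rightarrow> 'h) set" where
  "isos G G' = {j.
     (\<forall>i. j i \<in> extensional (halfedges G i) \<and>
          bij_betw (j i) (halfedges G i) (halfedges G' i) \<and>
          (\<lambda>e. j i ` e) ` edges G i = edges G' i) \<and>
     (\<lambda>v. \<Union>i. j i ` (v \<inter> halfedges G i)) ` verts G = verts G'}"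

definition aut :: "('h, 'c::finite) ecgraph \<Rightarrow> ('c \<Rightarrow> 'h \<Rightarrow> 'h) set" where
  "aut G = isos G G"

text \<open>Every finite graph is isomorphic to one with labels in \<open>nat\<close>, so isomorphism
  classes are formed among these.\<close>

definition iso_rel :: "((nat, 'c::finite) ecgraph \<times> (nat, 'c) ecgraph) set" where
  "iso_rel = {(G, G'). ec_graph G \<and> ec_graph G' \<and> isos G G' \<noteq> {}}"

definition iso_classes :: "(nat, 'c::finite) ecgraph set set" where
  "iso_classes = {G. ec_graph G} // iso_rel"

definition rep :: "(nat, 'c::finite) ecgraph set \<Rightarrow> (nat, 'c) ecgraph" where
  "rep X = (SOME G. G \<in> X)"

definition all_edges :: "('h, 'c) ecgraph \<Rightarrow> 'h set set" where
  "all_edges G = (\<Union>i. edges G i)"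

definition euler_char :: "('h, 'c) ecgraph \<Rightarrow> int" where
  "euler_char G = int (card (verts G)) - int (card (all_edges G))"

definition deg :: "('h, 'c) ecgraph \<Rightarrow> 'h set \<Rightarrow> 'c \<Rightarrow> nat" where
  "deg G v = (\<lambda>i. card (v \<inter> halfedges G i))"

text \<open>For a monocoloured graph, whose only colour is \<open>1\<close>.\<close>

definition regular :: "nat \<Rightarrow> ('h, 1) ecgraph \<Rightarrow> bool" where
  "regular k G \<longleftrightarrow> (\<forall>v\<in>verts G. deg G v 1 = k)"

text \<open>A subgraph is a set \<open>\<gamma>\<close> of edges.\<close>

definition sub_deg :: "'h set set \<Rightarrow> 'h set \<Rightarrow> nat" where
  "sub_deg \<gamma> v = card (v \<inter> \<Union>\<gamma>)"


section \<open>The sum over graphs attached to a polynomial\<close>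

text \<open>The coefficient of \<open>x\<^sup>w / w!\<close> in \<open>V\<close>.\<close>

definition Lam :: "('c::finite, 'r::comm_ring_1) mpol \<Rightarrow> ('c \<Rightarrow> nat) \<Rightarrow> 'r" where
  "Lam V w = of_nat (\<Prod>i\<in>UNIV. fact (w i)) * Poly_Mapping.lookup V (Abs_poly_mapping w)"

text \<open>The coefficients of \<open>V\<close> are polynomials, over a field of characteristic \<open>0\<close>, in
  parameters indexed by \<open>'p\<close>.\<close>

definition graph_term ::
  "('c::finite, ('p, 'a::field_char_0) mpol) mpol \<Rightarrow> (nat, 'c) ecgraph \<Rightarrow> ('p, 'a) mpol" where
  "graph_term V G = Const (1 / of_nat (card (aut G))) * (\<Prod>v\<in>verts G. Lam V (deg G v))"

text \<open>There are in general infinitely many graphs of a given Euler characteristic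
  (because of vertices of degree \<open>1\<close> and \<open>2\<close>), and \<open>sum\<close> over an infinite set is \<open>0\<close>.
  The sum is therefore restricted to the classes with nonzero contribution, of which there are
  finitely many as soon as \<open>V\<close> has no terms of total degree less than \<open>3\<close>.\<close>

definition A_poly ::
  "('c::finite, ('p, 'a::field_char_0) mpol) mpol \<Rightarrow> nat \<Rightarrow> ('p, 'a) mpol" where
  "A_poly V n =
     (\<Sum>X \<in> {X \<in> iso_classes. euler_char (rep X) = - int n \<and> graph_term V (rep X) \<noteq> 0}.
        graph_term V (rep X))"


section \<open>The polynomial \<open>W\<close>\<close>

text \<open>The variables \<open>x\<^sub>1\<close> and \<open>x\<^sub>2\<close> are \<open>Var 1\<close> and \<open>Var 2\<close>; the elements of the
  numeral type \<open>2\<close> are \<open>1\<close> and \<open>2 = 0\<close>.\<close>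

datatype param = Par_J | Par_h

definition W :: "nat \<Rightarrow> (2, (param, 'a::field_char_0) mpol) mpol" where
  "W k = (\<Sum>i\<le>k.
     Const (Const (1 / (fact i * fact (k - i))) * Var Par_J ^ i * Var Par_h ^ (i mod 2))
       * Var 1 ^ i * Var 2 ^ (k - i))"

end

theory Submission
  imports Defs
begin

text \<open>
  Relabelling by bijections with \<open>{..<N}\<close> shows that an isomorphism class of graphs with \<open>N\<close>
  half-edges contains exactly \<open>N! / |Aut|\<close> graphs whose set of half-edges is \<open>{..<N}\<close>, for any
  number of colours. Hence, up to the factor \<open>N!\<close>, a sum over isomorphism classes weighted
  by \<open>1 / |Aut|\<close> is a plain sum over labelled graphs. On labelled graphs the theorem is a
  bijection: a 2-coloured graph is a monocoloured graph together with the set \<open>\<gamma>\<close> of its edges of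
  the first colour. Since \<open>W\<close> is homogeneous of degree \<open>k\<close>, only \<open>k\<close>-regular graphs contribute,
  and for these \<open>k\<close> and the Euler characteristic determine \<open>N\<close>.
\<close>

section \<open>Relabelling graphs\<close>

definition labels :: "('h, 'c) ecgraph \<Rightarrow> 'h set" where
  "labels G = (\<Union>i. halfedges G i)"

definition relabel :: "('h \<Rightarrow> 'h) \<Rightarrow> ('h, 'c) ecgraph \<Rightarrow> ('h, 'c) ecgraph" where
  "relabel p G = ECGraph ((`) p ` verts G) (\<lambda>i. (`) p ` edges G i)"

text \<open>A single injection on the union of all half-edge sets stands in for the tuple of
  bijections in \<open>isos\<close>. It composes and inverts as an ordinary map, and
  \<open>extensional\<close> keeps distinct elements distinct as maps on labels, so that
  \<open>card\<close> counts them.\<close>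

definition relabellings :: "('h, 'c) ecgraph \<Rightarrow> ('h, 'c) ecgraph \<Rightarrow> ('h \<Rightarrow> 'h) set" where
  "relabellings G G' = {p \<in> extensional (labels G). inj_on p (labels G) \<and> relabel p G = G'}"

lemma verts_relabel [simp]: "verts (relabel p G) = (`) p ` verts G"
  and edges_relabel [simp]: "edges (relabel p G) i = (`) p ` edges G i"
  by (simp_all add: relabel_def)

lemma halfedges_relabel [simp]: "halfedges (relabel p G) i = p ` halfedges G i"
  by (auto simp: halfedges_def)

lemma labels_relabel [simp]: "labels (relabel p G) = p ` labels G"
  by (auto simp: labels_def)

lemma halfedges_subset_labels: "halfedges G i \<subseteq> labels G"
  by (auto simp: labels_def)

lemma edge_subset_halfedges: "e \<in> edges G i \<Longrightarrow> e \<subseteq> halfedges G i"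
  by (auto simp: halfedges_def)

lemma finite_labels: "ec_graph G \<Longrightarrow> finite (labels G)"
  by (simp add: ec_graph_def labels_def)

lemma partition_verts: "ec_graph G \<Longrightarrow> partition_on (labels G) (verts G)"
  by (simp add: ec_graph_def labels_def)

lemma partition_edges: "ec_graph G \<Longrightarrow> partition_on (halfedges G i) (edges G i)"
  by (simp add: ec_graph_def)

lemma card_edge: "ec_graph G \<Longrightarrow> e \<in> edges G i \<Longrightarrow> card e = 2"
  by (simp add: ec_graph_def)

lemma Union_verts: "ec_graph G \<Longrightarrow> \<Union>(verts G) = labels G"
  by (rule partition_onD1[OF partition_verts, symmetric])

lemma vert_subset_labels: "ec_graph G \<Longrightarrow> v \<in> verts G \<Longrightarrow> v \<subseteq> labels G"
  using Union_verts by blast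

lemma finite_verts: "ec_graph G \<Longrightarrow> finite (verts G)"
  using finite_elements[OF finite_labels partition_verts] .

lemma finite_edges: "ec_graph G \<Longrightarrow> finite (edges G i)"
  by (rule finite_elements[OF _ partition_edges]) (auto simp: ec_graph_def)

lemma halfedges_disjoint:
  "ec_graph G \<Longrightarrow> x \<in> halfedges G i \<Longrightarrow> x \<in> halfedges G j \<Longrightarrow> i = j"
  by (auto simp: ec_graph_def disjoint_family_on_def)

lemma disjoint_edges:
  assumes "ec_graph G" "e \<in> edges G i" "e \<in> edges G j" shows "i = j"
proof -
  obtain x where "x \<in> e" using card_edge[OF assms(1,2)] by fastforce
  then show ?thesis
    using edge_subset_halfedges[OF assms(2)] edge_subset_halfedges[OF assms(3)] halfedges_disjoint[OF assms(1)]
    by blast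
qed

text \<open>Two edges of one colour are disjoint as blocks of a partition; edges of different
  colours are disjoint because the half-edge sets of the colours are.\<close>

lemma partition_on_all_edges:
  assumes "ec_graph G" shows "partition_on (labels G) (all_edges G)"
proof (rule partition_onI)
  show "\<Union>(all_edges G) = labels G"
    by (auto simp: all_edges_def labels_def halfedges_def)
  show "disjnt e f" if ef: "e \<in> all_edges G" "f \<in> all_edges G" "e \<noteq> f" for e f
  proof -
    obtain i j where ij: "e \<in> edges G i" "f \<in> edges G j"
      using ef by (auto simp: all_edges_def)
    show ?thesis
    proof (cases "i = j")
      case True
      then show ?thesis
        using ij that partition_onD2[OF partition_edges[OF assms, of i]]
        by (auto simp: pairwise_def)
    next
      case False
      have "x \<notin> f" if "x \<in> e" for x
        using that False halfedges_disjoint[OF assms] edge_subset_halfedges[OF ij(1)]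
          edge_subset_halfedges[OF ij(2)] by blast
      then show ?thesis
        by (auto simp: disjnt_iff)
    qed
  qed
  show "{} \<notin> all_edges G"
    using partition_onD3[OF partition_edges[OF assms]] by (simp add: all_edges_def)
qed

text \<open>\<open>partition_on_inj_image\<close> removes the empty set from the image family. A
  block is never empty, so here nothing is removed.\<close>

lemma partition_on_inj_image':
  "partition_on A P \<Longrightarrow> inj_on f A \<Longrightarrow> partition_on (f ` A) ((`) f ` P)"
  using partition_on_inj_image[of A P f] partition_onD3[of A P] by (auto simp: image_iff)

lemma ec_graph_relabel:
  assumes G: "ec_graph G" and p: "inj_on p (labels G)"
  shows "ec_graph (relabel p G)"
proof -
  have pi: "inj_on p (halfedges G i)" for i
    by (rule inj_on_subset[OF p halfedges_subset_labels])
  have disj: "disjoint_family (\<lambda>i. p ` halfedges G i)"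
    unfolding disjoint_family_on_def
  proof (intro ballI impI)
    fix i j :: 'b assume "i \<noteq> j"
    then have "halfedges G i \<inter> halfedges G j = {}"
      using halfedges_disjoint[OF G] by blast
    then show "p ` halfedges G i \<inter> p ` halfedges G j = {}"
      using inj_on_image_Int[OF p halfedges_subset_labels halfedges_subset_labels, of i j] by simp
  qed
  have c: "card (p ` e) = 2" if "e \<in> edges G i" for e i
    using card_image[OF inj_on_subset[OF pi edge_subset_halfedges[OF that]]] card_edge[OF G that]
    by simp
  have V: "partition_on (\<Union>i. p ` halfedges G i) ((`) p ` verts G)"
    using partition_on_inj_image'[OF partition_verts[OF G] p] by (simp add: labels_def image_UN)
  show ?thesis
    unfolding ec_graph_def halfedges_relabel edges_relabel verts_relabel
    using disj c V partition_on_inj_image'[OF partition_edges[OF G] pi] G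
    by (auto simp: ec_graph_def)
qed

lemma relabel_cong:
  assumes "ec_graph G" "\<And>x. x \<in> labels G \<Longrightarrow> p x = q x"
  shows "relabel p G = relabel q G"
proof -
  have *: "p ` v = q ` v" if "v \<subseteq> labels G" for v
    using that assms(2) by (auto intro!: image_cong)
  have "(`) p ` verts G = (`) q ` verts G"
    by (rule image_cong[OF refl *]) (rule vert_subset_labels[OF assms(1)])
  moreover have "(`) p ` edges G i = (`) q ` edges G i" for i
    by (rule image_cong[OF refl *])
       (rule order.trans[OF edge_subset_halfedges halfedges_subset_labels])
  ultimately show ?thesis by (simp add: relabel_def)
qed

lemma relabel_id: "ec_graph G \<Longrightarrow> (\<And>x. x \<in> labels G \<Longrightarrow> p x = x) \<Longrightarrow> relabel p G = G"
  using relabel_cong[of G p id] by (cases G) (simp add: relabel_def)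

lemma relabel_comp: "relabel p (relabel q G) = relabel (p \<circ> q) G"
  by (simp add: relabel_def image_image image_comp)

lemma relabel_inv_into:
  assumes "ec_graph G" "inj_on p (labels G)"
  shows "relabel (inv_into (labels G) p) (relabel p G) = G"
  using assms by (simp add: relabel_comp relabel_id)

lemma image_vert:
  assumes "ec_graph G" "v \<in> verts G" "\<And>i x. x \<in> halfedges G i \<Longrightarrow> q i x = p x"
  shows "(\<Union>i. q i ` (v \<inter> halfedges G i)) = p ` v"
proof -
  have "(\<Union>i. q i ` (v \<inter> halfedges G i)) = (\<Union>i. p ` (v \<inter> halfedges G i))"
    using assms(3) by (intro SUP_cong image_cong) auto
  also have "\<dots> = p ` (\<Union>i. v \<inter> halfedges G i)"
    by (rule image_UN[symmetric])
  also have "(\<Union>i. v \<inter> halfedges G i) = v"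
    using vert_subset_labels[OF assms(1,2)] by (auto simp: labels_def)
  finally show ?thesis .
qed

text \<open>Since the half-edge sets are disjoint and cover the labels, a map on labels is the same
  as a tuple of maps, one for each colour: restrict in one direction, glue in the other.\<close>

lemma bij_betw_relabellings_isos:
  assumes G: "ec_graph G" and G': "ec_graph G'"
  shows "bij_betw (\<lambda>p i. restrict p (halfedges G i)) (relabellings G G') (isos G G')"
proof (rule bij_betw_imageI)
  show "inj_on (\<lambda>p i. restrict p (halfedges G i)) (relabellings G G')"
  proof (rule inj_onI)
    fix p q assume pq: "p \<in> relabellings G G'" "q \<in> relabellings G G'"
      and eq: "(\<lambda>i. restrict p (halfedges G i)) = (\<lambda>i. restrict q (halfedges G i))"
    show "p = q"
    proof (rule extensionalityI[of _ "labels G"])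
      fix x assume "x \<in> labels G"
      then obtain i where "x \<in> halfedges G i" by (auto simp: labels_def)
      then show "p x = q x" using fun_cong[OF eq, of i] by (metis restrict_apply')
    qed (use pq in \<open>auto simp: relabellings_def\<close>)
  qed
  show "(\<lambda>p i. restrict p (halfedges G i)) ` relabellings G G' = isos G G'"
  proof safe
    fix p assume p: "p \<in> relabellings G G'"
    then have inj: "inj_on p (labels G)" and eq: "G' = relabel p G"
      by (auto simp: relabellings_def)
    have "inj_on p (halfedges G i)" for i
      by (rule inj_on_subset[OF inj halfedges_subset_labels])
    moreover have "restrict p (halfedges G i) ` e = p ` e" if "e \<in> edges G i" for e i
      using edge_subset_halfedges[OF that] by (auto intro!: image_cong)
    moreover have "(\<Union>i. restrict p (halfedges G i) ` (v \<inter> halfedges G i)) = p ` v"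
      if "v \<in> verts G" for v
      by (rule image_vert[OF G that]) simp
    ultimately show "(\<lambda>i. restrict p (halfedges G i)) \<in> isos G G'"
      by (auto simp: isos_def eq bij_betw_def)
  next
    fix j assume j: "j \<in> isos G G'"
    have j1: "j i \<in> extensional (halfedges G i)"
         "bij_betw (j i) (halfedges G i) (halfedges G' i)"
         "(\<lambda>e. j i ` e) ` edges G i = edges G' i" for i
      using j by (auto simp: isos_def)
    have j2: "(\<lambda>v. \<Union>i. j i ` (v \<inter> halfedges G i)) ` verts G = verts G'"
      using j by (simp add: isos_def)
    \<comment> \<open>The glued map: \<open>THE i\<close> is the unique colour of the half-edge
      \<open>x\<close>.\<close>
    define p where "p = restrict (\<lambda>x. j (THE i. x \<in> halfedges G i) x) (labels G)"
    have p: "p x = j i x" if "x \<in> halfedges G i" for x i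
    proof -
      have "(THE i. x \<in> halfedges G i) = i"
        using that halfedges_disjoint[OF G] by (intro the_equality)
      then show ?thesis
        using subsetD[OF halfedges_subset_labels that] by (simp add: p_def)
    qed
    have "inj_on p (labels G)"
    proof (rule inj_onI)
      fix x y assume xy: "x \<in> labels G" "y \<in> labels G" "p x = p y"
      obtain i where i: "x \<in> halfedges G i" using xy by (auto simp: labels_def)
      obtain i' where i': "y \<in> halfedges G i'" using xy by (auto simp: labels_def)
      \<comment> \<open>Half-edges of different colours cannot collide, because their images lie in
        disjoint half-edge sets of \<open>G'\<close>. This reduces injectivity to a single
        colour.\<close>
      have "p x \<in> halfedges G' i" "p y \<in> halfedges G' i'"
        using bij_betwE[OF j1(2)] i i' by (simp_all add: p)
      then have "i = i'" using xy halfedges_disjoint[OF G'] by metis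
      then have "j i x = j i y" using xy(3) p[OF i] p[OF i'] by simp
      then show "x = y"
        using bij_betw_imp_inj_on[OF j1(2)] i i' \<open>i = i'\<close> by (metis inj_onD)
    qed
    moreover have "relabel p G = G'"
    proof -
      have V: "(`) p ` verts G = verts G'"
        unfolding j2[symmetric] by (intro image_cong refl image_vert[OF G, symmetric]) (simp_all add: p)
      have "p ` e = j i ` e" if "e \<in> edges G i" for e i
        using p subsetD[OF edge_subset_halfedges[OF that]] by (intro image_cong) auto
      then have "(`) p ` edges G i = edges G' i" for i
        unfolding j1(3)[of i, symmetric] by (rule image_cong[OF refl])
      then show ?thesis using V by (cases G') (simp add: relabel_def)
    qed
    ultimately have "p \<in> relabellings G G'" by (simp add: relabellings_def p_def)
    moreover have "j = (\<lambda>i. restrict p (halfedges G i))"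
      using j1(1) p by (auto simp: fun_eq_iff extensional_def)
    ultimately show "j \<in> (\<lambda>p i. restrict p (halfedges G i)) ` relabellings G G'" by blast
  qed
qed

lemma card_isos: "ec_graph G \<Longrightarrow> ec_graph G' \<Longrightarrow> card (isos G G') = card (relabellings G G')"
  using bij_betw_same_card[OF bij_betw_relabellings_isos] by metis

text \<open>Relabelling along an injection preserves being a graph, so \<open>ec_graph G'\<close>
  comes for free. In this form the axioms of an equivalence relation follow from the identity map,
  composition and inverses.\<close>

lemma iso_rel_iff:
  "(G, G') \<in> iso_rel \<longleftrightarrow> ec_graph G \<and> (\<exists>p. inj_on p (labels G) \<and> G' = relabel p G)"
proof
  assume "(G, G') \<in> iso_rel"
  then show "ec_graph G \<and> (\<exists>p. inj_on p (labels G) \<and> G' = relabel p G)"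
    using bij_betw_relabellings_isos[of G G']
    by (auto simp: iso_rel_def bij_betw_def relabellings_def)
next
  assume R: "ec_graph G \<and> (\<exists>p. inj_on p (labels G) \<and> G' = relabel p G)"
  then obtain p where p: "ec_graph G" "inj_on p (labels G)" "G' = relabel p G" by blast
  have "relabel (restrict p (labels G)) G = G'"
    using relabel_cong[OF p(1), of "restrict p (labels G)" p] p by simp
  then have "restrict p (labels G) \<in> relabellings G G'"
    using p by (simp add: relabellings_def)
  moreover have "ec_graph G'" using p ec_graph_relabel by blast
  ultimately show "(G, G') \<in> iso_rel"
    using bij_betw_relabellings_isos[of G G'] p(1)
    by (auto simp: iso_rel_def bij_betw_def)
qed

lemma equiv_iso_rel:
  "equiv {G. ec_graph G} (iso_rel :: ((nat, 'c::finite) ecgraph \<times> _) set)"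
  (is "equiv ?A ?r")
proof (rule equivI)
  show "?r \<subseteq> ?A \<times> ?A"
    by (auto simp: iso_rel_def)
  show "refl_on ?A ?r"
    using relabel_id[of _ id] by (fastforce simp: refl_on_def iso_rel_iff intro: exI[of _ id])
  show "sym ?r"
  proof (rule symI)
    fix G G' :: "(nat, 'c) ecgraph" assume "(G, G') \<in> iso_rel"
    then obtain p where p: "ec_graph G" "inj_on p (labels G)" "G' = relabel p G"
      by (auto simp: iso_rel_iff)
    then show "(G', G) \<in> iso_rel"
      using relabel_inv_into[OF p(1,2)] inj_on_inv_into[of "p ` labels G" p "labels G"]
        ec_graph_relabel[OF p(1,2)]
      by (auto simp: iso_rel_iff)
  qed
  show "trans ?r"
    by (rule transI) (auto simp: iso_rel_iff relabel_comp, metis comp_inj_on)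
qed

text \<open>Classes are nonempty, so \<open>rep\<close> really picks a member; a class is then the
  set of all relabellings of that member.\<close>

lemma
  assumes "X \<in> iso_classes"
  shows ec_graph_rep: "ec_graph (rep X)"
    and class_eq: "X = {G. (rep X, G) \<in> iso_rel}"
proof -
  have "X \<noteq> {}" "X \<subseteq> {G. ec_graph G}"
    using assms equiv_iso_rel in_quotient_imp_non_empty in_quotient_imp_subset
    unfolding iso_classes_def by metis+
  then have *: "rep X \<in> X"
    unfolding rep_def by (metis ex_in_conv someI_ex)
  then show "ec_graph (rep X)"
    using \<open>X \<subseteq> {G. ec_graph G}\<close> by auto
  obtain G where G: "X = iso_rel `` {G}"
    using assms unfolding iso_classes_def by (rule quotientE)
  then have "iso_rel `` {G} = iso_rel `` {rep X}"
    using * by (intro equiv_class_eq[OF equiv_iso_rel]) auto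
  with G have "X = iso_rel `` {rep X}" by simp
  then show "X = {G. (rep X, G) \<in> iso_rel}" by auto
qed

section \<open>Counting labelled graphs\<close>

definition labelled_graphs :: "nat \<Rightarrow> (nat, 'c::finite) ecgraph set" where
  "labelled_graphs N = {G. ec_graph G \<and> labels G = {..<N}}"

text \<open>There are finitely many colours, and vertices and edges are all subsets of
  \<open>{..<N}\<close>, which leaves finitely many choices.\<close>

lemma finite_labelled_graphs: "finite (labelled_graphs N :: (nat, 'c::finite) ecgraph set)"
proof (rule finite_subset)
  let ?E = "UNIV \<rightarrow>\<^sub>E Pow (Pow {..<N}) :: ('c \<Rightarrow> nat set set) set"
  show "labelled_graphs N \<subseteq> (\<lambda>(v, e). ECGraph v e) ` (Pow (Pow {..<N}) \<times> ?E)"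
  proof
    fix G :: "(nat, 'c) ecgraph" assume "G \<in> labelled_graphs N"
    then have G: "ec_graph G" "labels G = {..<N}" by (auto simp: labelled_graphs_def)
    have "verts G \<subseteq> Pow {..<N}" using vert_subset_labels[OF G(1)] G(2) by auto
    moreover have "edges G i \<subseteq> Pow {..<N}" for i
      using edge_subset_halfedges[of _ G i] halfedges_subset_labels[of G i] G(2) by blast
    ultimately show "G \<in> (\<lambda>(v, e). ECGraph v e) ` (Pow (Pow {..<N}) \<times> ?E)"
      by (intro image_eqI[of _ _ "(verts G, edges G)"]) auto
  qed
  show "finite ((\<lambda>(v, e). ECGraph v e) ` (Pow (Pow {..<N}) \<times> ?E))"
    by (intro finite_imageI finite_cartesian_product finite_PiE) auto
qed

text \<open>Once one relabelling \<open>p\<close> of \<open>G\<close> onto \<open>G'\<close> is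
  fixed, every other one is \<open>p\<close> after an automorphism. The inverse correspondence
  composes with the inverse of \<open>p\<close>.\<close>

lemma card_relabellings:
  assumes G: "ec_graph G" and ne: "relabellings G G' \<noteq> {}"
  shows "card (relabellings G G') = card (aut G)"
proof -
  obtain p where p: "inj_on p (labels G)" "G' = relabel p G"
    using ne by (auto simp: relabellings_def)
  let ?q = "inv_into (labels G) p"
  have "bij_betw (\<lambda>q. restrict (p \<circ> q) (labels G)) (relabellings G G) (relabellings G G')"
  proof (rule bij_betw_byWitness[of _ "\<lambda>r. restrict (?q \<circ> r) (labels G)"])
    \<comment> \<open>All relabellings onto \<open>G'\<close> have the same range, the labels of
      \<open>G'\<close>; hence \<open>?q\<close> inverts \<open>p\<close> on every value that they
      take.\<close>
    have lab: "r ` labels G = p ` labels G" if "r \<in> relabellings G G'" for r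
    proof -
      have "labels (relabel r G) = labels (relabel p G)"
        using that p(2) by (simp add: relabellings_def del: labels_relabel)
      then show ?thesis by simp
    qed
    have lab0: "r ` labels G = labels G" if "r \<in> relabellings G G" for r
    proof -
      have "labels (relabel r G) = labels G"
        using that by (simp add: relabellings_def del: labels_relabel)
      then show ?thesis by simp
    qed
    show "\<forall>q\<in>relabellings G G.
        restrict (?q \<circ> restrict (p \<circ> q) (labels G)) (labels G) = q"
    proof
      fix q assume q: "q \<in> relabellings G G"
      show "restrict (?q \<circ> restrict (p \<circ> q) (labels G)) (labels G) = q"
        using q lab0[OF q] p inv_into_f_f[OF p(1)]
        by (intro extensionalityI[of _ "labels G"]) (fastforce simp: relabellings_def)+
    qed
    show "\<forall>r\<in>relabellings G G'.
        restrict (p \<circ> restrict (?q \<circ> r) (labels G)) (labels G) = r"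
    proof
      fix r assume r: "r \<in> relabellings G G'"
      show "restrict (p \<circ> restrict (?q \<circ> r) (labels G)) (labels G) = r"
        using r lab[OF r] p
        by (intro extensionalityI[of _ "labels G"])
           (auto simp: relabellings_def intro!: f_inv_into_f)
    qed
    show "(\<lambda>q. restrict (p \<circ> q) (labels G)) ` relabellings G G \<subseteq> relabellings G G'"
    proof clarify
      fix q assume q: "q \<in> relabellings G G"
      then have "inj_on (p \<circ> q) (labels G)" "relabel (p \<circ> q) G = G'"
        using p lab0[OF q] by (auto simp: relabellings_def intro!: comp_inj_on simp flip: relabel_comp)
      then show "restrict (p \<circ> q) (labels G) \<in> relabellings G G'"
        using relabel_cong[OF G, of "restrict (p \<circ> q) (labels G)" "p \<circ> q"]
        by (simp add: relabellings_def)
    qed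
    show "(\<lambda>r. restrict (?q \<circ> r) (labels G)) ` relabellings G G' \<subseteq> relabellings G G"
    proof clarify
      fix r assume r: "r \<in> relabellings G G'"
      then have "inj_on (?q \<circ> r) (labels G)"
        using lab[OF r] by (auto simp: relabellings_def intro!: comp_inj_on inj_on_inv_into)
      moreover have "relabel (?q \<circ> r) G = G"
        using r relabel_inv_into[OF G p(1)] p(2) by (auto simp: relabellings_def simp flip: relabel_comp)
      ultimately show "restrict (?q \<circ> r) (labels G) \<in> relabellings G G"
        using relabel_cong[OF G, of "restrict (?q \<circ> r) (labels G)" "?q \<circ> r"]
        by (simp add: relabellings_def)
    qed
  qed
  then show ?thesis
    using bij_betw_same_card card_isos[OF G G] by (metis aut_def)
qed

text \<open>Between finite sets of equal size an injection is onto, and the falling factorial that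
  counts injections becomes a full factorial.\<close>

lemma card_bijections:
  assumes "finite A" "finite B" "card A = card B"
  shows "card {f \<in> extensional A. bij_betw f A B} = fact (card A)"
proof -
  have "bij_betw f A B \<longleftrightarrow> f \<in> A \<rightarrow> B \<and> inj_on f A" for f
    using assms card_subset_eq[of B "f ` A"] by (auto simp: bij_betw_def card_image image_subset_iff_funcset)
  then have "{f \<in> extensional A. bij_betw f A B} = {f \<in> A \<rightarrow>\<^sub>E B. inj_on f A}"
    by (auto simp: PiE_def)
  then show ?thesis
    using card_inj_on_subset_funcset[OF assms(1,2) order.refl] assms(3)
    by (simp add: fact_prod_rev)
qed

text \<open>This is the orbit-stabiliser argument: sort the \<open>N!\<close> bijections from the
  labels of \<open>rep X\<close> to \<open>{..<N}\<close> by the graph that they produce. These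
  graphs are the members of the class on \<open>{..<N}\<close>, and each is produced by as many
  bijections as there are automorphisms.\<close>

lemma card_class_mult_card_aut:
  assumes X: "X \<in> iso_classes" and N: "card (labels (rep X)) = N"
  shows "card (X \<inter> labelled_graphs N) * card (aut (rep X)) = fact N"
proof -
  let ?G = "rep X"
  have G: "ec_graph ?G" by (rule ec_graph_rep[OF X])
  let ?B = "{p \<in> extensional (labels ?G). bij_betw p (labels ?G) {..<N}}"
  have B: "?B = (\<Union>G' \<in> X \<inter> labelled_graphs N. relabellings ?G G')"
    using class_eq[OF X] G ec_graph_relabel[OF G]
    by (auto simp: relabellings_def bij_betw_def labelled_graphs_def iso_rel_iff)
  have "fact N = card ?B"
    using card_bijections[of "labels ?G" "{..<N}"] N finite_labels[OF G] by simp
  \<comment> \<open>\<open>card\<close> is 0 on infinite sets, so a positive cardinality proves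
    finiteness.\<close>
  moreover have "finite ?B"
    using calculation by (intro card_ge_0_finite) (metis fact_gt_zero)
  moreover have "card ?B = (\<Sum>G' \<in> X \<inter> labelled_graphs N. card (relabellings ?G G'))"
    unfolding B
  proof (rule card_UN_disjoint)
    show "\<forall>G'\<in>X \<inter> labelled_graphs N. finite (relabellings ?G G')"
      using \<open>finite ?B\<close> unfolding B by (meson UN_upper finite_subset)
  qed (auto simp: finite_labelled_graphs relabellings_def)
  moreover have "card (relabellings ?G G') = card (aut ?G)" if "G' \<in> X \<inter> labelled_graphs N" for G'
  proof (rule card_relabellings[OF G])
    have "(?G, G') \<in> iso_rel" using that class_eq[OF X] by blast
    then show "relabellings ?G G' \<noteq> {}"
      using bij_betw_relabellings_isos[of ?G G'] by (auto simp: iso_rel_def bij_betw_def)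
  qed
  ultimately show ?thesis by simp
qed

section \<open>From labelled graphs to isomorphism classes\<close>

definition relabel_invariant :: "((nat, 'c::finite) ecgraph \<Rightarrow> 'r) \<Rightarrow> bool" where
  "relabel_invariant f \<longleftrightarrow>
     (\<forall>G p. ec_graph G \<longrightarrow> inj_on p (labels G) \<longrightarrow> f (relabel p G) = f G)"

lemma Const_mult: "Const (a * b) = Const a * (Const b :: ('v, 'r::comm_ring_1) mpol)"
  by (simp add: Const_def mult_single)

lemma Const_of_nat: "Const (of_nat n) = (of_nat n :: ('v, 'r::comm_ring_1) mpol)"
  by (simp add: Const_def)

lemma card_labels_relabel: "inj_on p (labels G) \<Longrightarrow> card (labels (relabel p G)) = card (labels G)"
  by (simp add: card_image)

lemma iso_classes_cover:
  assumes "ec_graph G" 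
  shows "iso_rel `` {G} \<in> iso_classes" "G \<in> iso_rel `` {G}"
  using assms equiv_class_self[OF equiv_iso_rel] by (auto simp: iso_classes_def quotient_def)

lemma mem_class_unique:
  assumes "X \<in> iso_classes" "Y \<in> iso_classes" "G \<in> X" "G \<in> Y"
  shows "X = Y"
  using quotient_disj[OF equiv_iso_rel, of X Y] assms by (auto simp: iso_classes_def)

text \<open>The product in \<open>card_class_mult_card_aut\<close> is a factorial and so nonzero.
  Each class therefore meets the finite set of labelled graphs, and distinct classes meet it in
  disjoint sets.\<close>

lemma finite_classes:
  "finite {X \<in> iso_classes :: (nat, 'c::finite) ecgraph set set. card (labels (rep X)) = N}"
  (is "finite ?I")
proof (rule finite_subset)
  show "?I \<subseteq> (\<lambda>G. iso_rel `` {G}) ` labelled_graphs N"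
  proof safe
    fix X :: "(nat, 'c) ecgraph set"
    assume X: "X \<in> iso_classes" "N = card (labels (rep X))"
    then have "card (X \<inter> labelled_graphs N) \<noteq> 0"
      using card_class_mult_card_aut[of X N] by (metis fact_nonzero mult_eq_0_iff)
    then obtain G where G: "G \<in> X" "G \<in> labelled_graphs N" by (metis card.empty disjoint_iff)
    then have "X = iso_rel `` {G}"
      using mem_class_unique[OF X(1)] iso_classes_cover[of G] by (auto simp: labelled_graphs_def)
    then show "X \<in> (\<lambda>G. iso_rel `` {G}) ` labelled_graphs (card (labels (rep X)))"
      using G X by auto
  qed
qed (simp add: finite_labelled_graphs)

text \<open>Split the labelled graphs by class. The summand is constant on a class, and a class with
  \<open>N\<close> half-edges contains \<open>N! / |Aut|\<close> labelled graphs.\<close>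

lemma sum_labelled_graphs:
  fixes f :: "(nat, 'c::finite) ecgraph \<Rightarrow> ('p, 'a::field_char_0) mpol"
  assumes inv: "relabel_invariant f"
  shows "(\<Sum>G \<in> labelled_graphs N. f G) = of_nat (fact N) *
    (\<Sum>X \<in> {X \<in> iso_classes. card (labels (rep X)) = N}.
       Const (1 / of_nat (card (aut (rep X)))) * f (rep X))"
proof -
  let ?I = "{X \<in> iso_classes. card (labels (rep X)) = N} :: (nat, 'c) ecgraph set set"
  have f: "f G = f (rep X)" and c: "card (labels G) = card (labels (rep X))"
    if XG: "X \<in> iso_classes" "G \<in> X" for X G
  proof -
    obtain p where "inj_on p (labels (rep X))" "G = relabel p (rep X)"
      using class_eq[OF XG(1)] XG(2) iso_rel_iff by blast
    then show "f G = f (rep X)" "card (labels G) = card (labels (rep X))"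
      using inv ec_graph_rep[OF XG(1)] card_labels_relabel by (auto simp: relabel_invariant_def)
  qed
  have U: "labelled_graphs N = (\<Union>X \<in> ?I. X \<inter> labelled_graphs N)"
  proof safe
    fix G :: "(nat, 'c) ecgraph" assume G: "G \<in> labelled_graphs N"
    then have *: "iso_rel `` {G} \<in> iso_classes" "G \<in> iso_rel `` {G}"
      using iso_classes_cover by (auto simp: labelled_graphs_def)
    then have "card (labels (rep (iso_rel `` {G}))) = N"
      using c[OF *] G by (simp add: labelled_graphs_def)
    then show "G \<in> (\<Union>X \<in> ?I. X \<inter> labelled_graphs N)" using * G by blast
  qed
  have "(\<Sum>G \<in> labelled_graphs N. f G) = (\<Sum>X \<in> ?I. \<Sum>G \<in> X \<inter> labelled_graphs N. f G)"
    by (subst U, rule sum.UNION_disjoint)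
       (use mem_class_unique in \<open>auto simp: finite_classes finite_labelled_graphs\<close>)
  also have "\<dots> = (\<Sum>X \<in> ?I. of_nat (fact N) * (Const (1 / of_nat (card (aut (rep X)))) * f (rep X)))"
  proof (rule sum.cong[OF refl])
    fix X assume X: "X \<in> ?I"
    have m: "card (X \<inter> labelled_graphs N) * card (aut (rep X)) = fact N"
      using card_class_mult_card_aut X by blast
    \<comment> \<open>This excludes the default value \<open>1 / 0 = 0\<close>.\<close>
    then have "card (aut (rep X)) \<noteq> 0" by (metis fact_nonzero mult_0_right)
    then have "of_nat (card (X \<inter> labelled_graphs N)) =
        (of_nat (fact N) * (1 / of_nat (card (aut (rep X)))) :: 'a)"
      by (simp flip: m)
    \<comment> \<open>The division takes place in the coefficient field; \<open>Const\<close>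
      carries the resulting identity over to polynomials.\<close>
    then have "(of_nat (card (X \<inter> labelled_graphs N)) :: ('p, 'a) mpol) =
        of_nat (fact N) * Const (1 / of_nat (card (aut (rep X))))"
      by (metis Const_mult Const_of_nat)
    moreover have "(\<Sum>G \<in> X \<inter> labelled_graphs N. f G) = (\<Sum>G \<in> X \<inter> labelled_graphs N. f (rep X))"
      using f X by (intro sum.cong) auto
    ultimately show "(\<Sum>G \<in> X \<inter> labelled_graphs N. f G) =
        of_nat (fact N) * (Const (1 / of_nat (card (aut (rep X)))) * f (rep X))"
      by (simp add: mult.assoc)
  qed
  finally show ?thesis by (simp add: sum_distrib_left)
qed

section \<open>Half-edges of regular graphs\<close>

lemma UNIV_2: "(UNIV :: 2 set) = {1, 2}"
proof -
  have "(x :: 2) = 1 \<or> x = 2" for x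
  \<comment> \<open>The induction represents \<open>x\<close> by an integer from 0 to 1, and 0
    equals \<open>2\<close> in this type.\<close>
  proof (induct x)
    case (of_int z)
    then have "z = 0 \<or> z = 1" by fastforce
    then show ?case by auto
  qed
  then show ?thesis by auto
qed

lemma UNIV_1: "(UNIV :: 1 set) = {1}"
  using forall_1[of "\<lambda>x. x = 1"] by auto

lemma card_labels:
  assumes G: "ec_graph G"
  shows "card (labels G) = 2 * card (all_edges G)"
proof -
  have e: "card e = 2" if "e \<in> all_edges G" for e
    using that card_edge[OF G] by (auto simp: all_edges_def)
  then have "finite e" if "e \<in> all_edges G" for e
    using that by (metis card.infinite zero_neq_numeral)
  then have "card (labels G) = (\<Sum>e\<in>all_edges G. card e)"
    using product_partition[OF partition_on_all_edges[OF G]] by blast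
  then show ?thesis using e by simp
qed

lemma card_labels_verts:
  assumes G: "ec_graph G" and k: "\<And>v. v \<in> verts G \<Longrightarrow> card v = k"
  shows "card (labels G) = k * card (verts G)"
proof -
  have "finite v" if "v \<in> verts G" for v
    using vert_subset_labels[OF G that] finite_labels[OF G] by (rule finite_subset)
  then have "card (labels G) = (\<Sum>v\<in>verts G. card v)"
    using product_partition[OF partition_verts[OF G]] by blast
  then show ?thesis using k by simp
qed

text \<open>Counting half-edges by edges and by vertices gives \<open>2|E| = k|V|\<close>. With
  \<open>|E| = |V| + n\<close> this becomes \<open>(k - 2)|V| = 2n\<close>, and the number of
  half-edges is \<open>k|V|\<close>. As \<open>k - 2\<close> is positive, the division is
  exact.\<close>

lemma card_labels_regular:
  assumes G: "ec_graph G" and v: "\<And>v. v \<in> verts G \<Longrightarrow> card v = k"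
    and k: "k \<ge> 3" and n: "euler_char G = - int n"
  shows "card (labels G) = 2 * n * k div (k - 2)"
proof -
  have "2 * card (all_edges G) = k * card (verts G)"
    using card_labels[OF G] card_labels_verts[OF G v] by simp
  moreover have "card (all_edges G) = card (verts G) + n"
    using n by (simp add: euler_char_def)
  ultimately have "(k - 2) * card (verts G) = 2 * n"
    using k by (simp add: algebra_simps diff_mult_distrib)
  then have "2 * n * k = (k * card (verts G)) * (k - 2)"
    by (metis mult.assoc mult.commute)
  then show ?thesis
    using k card_labels_verts[OF G v] by simp
qed

lemma card_vert:
  fixes G :: "('h, 2) ecgraph"
  assumes G: "ec_graph G" and v: "v \<in> verts G"
  shows "card v = deg G v 1 + deg G v 2"
proof -
  have "v = (v \<inter> halfedges G 1) \<union> (v \<inter> halfedges G 2)"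
    using vert_subset_labels[OF G v] by (auto simp: labels_def UNIV_2)
  moreover have "(v \<inter> halfedges G 1) \<inter> (v \<inter> halfedges G 2) = {}"
    using halfedges_disjoint[OF G, of _ 1 2] by auto
  moreover have "finite v"
    using vert_subset_labels[OF G v] finite_labels[OF G] by (rule finite_subset)
  ultimately show ?thesis
    unfolding deg_def by (metis card_Un_disjoint finite_Un)
qed

section \<open>The coefficients of the polynomial\<close>

lemma Var_power: "Var i ^ m = (Poly_Mapping.single (Poly_Mapping.single i m) 1 :: ('v, 'r::comm_ring_1) mpol)"
proof (induction m)
  case (Suc m)
  then show ?case by (simp add: Var_def mult_single flip: single_add)
qed simp

lemma lookup_Const_mult:
  "Poly_Mapping.lookup (Const c * Poly_Mapping.single a 1) b = (if a = b then c else (0::'r::comm_ring_1))"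
  by (simp add: Const_def mult_single lookup_single when_def)

lemma single_add_single_eq_Abs:
  fixes w :: "2 \<Rightarrow> nat"
  shows "Poly_Mapping.single 1 i + Poly_Mapping.single 2 j = Abs_poly_mapping w \<longleftrightarrow> w 1 = i \<and> w 2 = j"
proof -
  \<comment> \<open>Every function on a finite type has finite support.\<close>
  have "Poly_Mapping.lookup (Abs_poly_mapping w) = w"
    by (rule Abs_poly_mapping_inverse) simp
  moreover have "f = g \<longleftrightarrow> f 1 = g 1 \<and> f 2 = g 2" for f g :: "2 \<Rightarrow> nat"
    using UNIV_2 by (metis UNIV_I ext insertE singletonD)
  ultimately show ?thesis
    by (auto simp: poly_mapping_eq_iff lookup_add lookup_single)
qed

text \<open>The monomials of \<open>W k\<close> are distinct for distinct \<open>i\<close>, so a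
  lookup meets at most one of them, and the factorials in \<open>Lam\<close> cancel those in its
  coefficient. The value 0 away from total degree \<open>k\<close> is what later forces
  regularity.\<close>

lemma Lam_W:
  "Lam (W k :: (2, (param, 'a::field_char_0) mpol) mpol) w =
    (if w 1 + w 2 = k then Var Par_J ^ w 1 * Var Par_h ^ (w 1 mod 2) else 0)"
proof -
  define c :: "nat \<Rightarrow> (param, 'a) mpol" where
    "c i = Const (1 / (fact i * fact (k - i))) * Var Par_J ^ i * Var Par_h ^ (i mod 2)" for i
  have "Poly_Mapping.lookup (W k) (Abs_poly_mapping w) =
      (\<Sum>i\<le>k. if w 1 = i \<and> w 2 = k - i then c i else 0)"
    \<comment> \<open>Fixing the variable type to \<open>2\<close> rewrites only the powers of
      \<open>Var 1\<close> and \<open>Var 2\<close>; the powers of the two parameters stay inside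
      the coefficient.\<close>
    by (simp add: W_def lookup_sum Var_power[where 'v = 2] mult.assoc mult_single lookup_Const_mult
        single_add_single_eq_Abs c_def cong: if_cong)
  \<comment> \<open>Within the range \<open>i \<le> k\<close> the truncated difference
    \<open>k - i\<close> is a true one.\<close>
  also have "\<dots> = (\<Sum>i\<le>k. if w 1 = i then (if w 1 + w 2 = k then c i else 0) else 0)"
    by (intro sum.cong) auto
  also have "\<dots> = (if w 1 + w 2 = k then c (w 1) else 0)"
    by simp
  finally have l: "Poly_Mapping.lookup (W k) (Abs_poly_mapping w) =
    (if w 1 + w 2 = k then c (w 1) else 0)" .
  show ?thesis
  proof (cases "w 1 + w 2 = k")
    case True
    have "of_nat (\<Prod>i\<in>UNIV. fact (w i)) * Const (1 / (fact (w 1) * fact (w 2))) =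
        (Const (of_nat (fact (w 1) * fact (w 2)) * (1 / (fact (w 1) * fact (w 2)))) :: (param, 'a) mpol)"
      unfolding Const_mult Const_of_nat by (simp add: UNIV_2)
    also have "\<dots> = 1"
      by (simp add: Const_def)
    finally show ?thesis
      using True by (auto simp: Lam_def l c_def mult.assoc[symmetric])
  qed (simp add: Lam_def l)
qed

section \<open>Subgraphs and colourings\<close>

text \<open>The subgraph receives colour 1 because in \<open>W\<close> the exponents of both
  parameters depend on the exponent of \<open>Var 1\<close>.\<close>

definition colour_subgraph :: "('h, 1) ecgraph \<Rightarrow> 'h set set \<Rightarrow> ('h, 2) ecgraph" where
  "colour_subgraph G \<gamma> = ECGraph (verts G) (\<lambda>i. if i = 1 then \<gamma> else all_edges G - \<gamma>)"

lemma all_edges_mono: "all_edges (G :: ('h, 1) ecgraph) = edges G 1"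
  by (simp add: all_edges_def UNIV_1)

lemma all_edges_const [simp]: "all_edges (ECGraph V (\<lambda>_. E)) = E"
  by (simp add: all_edges_def)

lemma labels_mono: "labels (G :: ('h, 1) ecgraph) = halfedges G 1"
  by (simp add: labels_def UNIV_1)

lemma verts_colour_subgraph [simp]: "verts (colour_subgraph G \<gamma>) = verts G"
  by (simp add: colour_subgraph_def)

lemma all_edges_colour_subgraph:
  "\<gamma> \<subseteq> all_edges G \<Longrightarrow> all_edges (colour_subgraph G \<gamma>) = all_edges G"
  by (simp add: all_edges_def[of "colour_subgraph G \<gamma>"] UNIV_2) (auto simp: colour_subgraph_def)

lemma halfedges_colour_subgraph:
  "halfedges (colour_subgraph G \<gamma>) i = (if i = 1 then \<Union>\<gamma> else \<Union>(all_edges G - \<gamma>))"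
  by (simp add: halfedges_def colour_subgraph_def)

lemma Union_all_edges: "\<Union>(all_edges G) = labels G"
  by (auto simp: all_edges_def labels_def halfedges_def)

lemma labels_colour_subgraph:
  "\<gamma> \<subseteq> all_edges G \<Longrightarrow> labels (colour_subgraph G \<gamma>) = labels G"
  using Union_all_edges[of "colour_subgraph G \<gamma>"] Union_all_edges[of G]
  by (simp add: all_edges_colour_subgraph)

lemma ec_graph_colour_subgraph:
  assumes G: "ec_graph G" and \<gamma>: "\<gamma> \<subseteq> all_edges G"
  shows "ec_graph (colour_subgraph G \<gamma>)"
proof -
  let ?H = "colour_subgraph G \<gamma>"
  have P: "partition_on (labels G) (all_edges G)" by (rule partition_on_all_edges[OF G])
  have sub: "edges ?H i \<subseteq> all_edges G" for i
    using \<gamma> by (auto simp: colour_subgraph_def)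
  have "partition_on (halfedges ?H i) (edges ?H i)" for i
    using P sub[of i] by (auto simp: partition_on_def halfedges_def intro: pairwise_subset)
  moreover have "finite (halfedges ?H i)" for i
    using finite_labels[OF G] labels_colour_subgraph[OF \<gamma>] halfedges_subset_labels finite_subset by metis
  moreover have "disjoint_family (halfedges ?H)"
  proof -
    have "\<Union>\<gamma> \<inter> \<Union>(all_edges G - \<gamma>) = {}"
      using partition_onD2[OF P] \<gamma> by (fastforce simp: disjoint_def)
    then show ?thesis
      by (auto simp: disjoint_family_on_def UNIV_2 halfedges_colour_subgraph Int_commute)
  qed
  moreover have "partition_on (\<Union>i. halfedges ?H i) (verts ?H)"
    using partition_verts[OF G] labels_colour_subgraph[OF \<gamma>] by (simp add: labels_def)
  moreover have "card e = 2" if "e \<in> edges ?H i" for e i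
    using sub[of i] that card_edge[OF G] by (auto simp: all_edges_mono)
  ultimately show ?thesis by (simp add: ec_graph_def)
qed

text \<open>With labels fixed, no symmetry identifies different subgraphs, so subgraph and colouring
  correspond exactly.\<close>

lemma colour_subgraph_bij:
  "bij_betw (\<lambda>(G, \<gamma>). colour_subgraph G \<gamma>) (SIGMA G:labelled_graphs N. Pow (all_edges G))
    (labelled_graphs N)"
  (is "bij_betw ?c ?A ?B")
proof -
  \<comment> \<open>The inverse forgets the colours but remembers which edges had colour 1.\<close>
  define f :: "(nat, 2) ecgraph \<Rightarrow> (nat, 1) ecgraph \<times> nat set set" where
    "f H = (ECGraph (verts H) (\<lambda>_. all_edges H), edges H 1)" for H
  show ?thesis
  proof (rule bij_betw_byWitness[of _ f])
    show "\<forall>x\<in>?A. f (?c x) = x"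
    proof clarify
      fix G :: "(nat, 1) ecgraph" and \<gamma> assume \<gamma>: "\<gamma> \<subseteq> all_edges G"
      have "ECGraph (verts G) (\<lambda>_. all_edges G) = G"
        by (cases G) (simp add: all_edges_mono fun_eq_iff)
      then show "f (colour_subgraph G \<gamma>) = (G, \<gamma>)"
        using \<gamma> by (simp add: f_def all_edges_colour_subgraph) (simp add: colour_subgraph_def)
    qed
  next
    show "\<forall>H\<in>?B. ?c (f H) = H"
    proof
      fix H :: "(nat, 2) ecgraph" assume "H \<in> ?B"
      then have H: "ec_graph H" by (simp add: labelled_graphs_def)
      \<comment> \<open>No edge has both colours, so the complement of colour 1 is exactly colour
        2.\<close>
      have "all_edges H - edges H 1 = edges H 2"
        using disjoint_edges[OF H, of _ 1 2] by (auto simp: all_edges_def UNIV_2)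
      then have "(\<lambda>i. if i = 1 then edges H 1 else all_edges H - edges H 1) = edges H"
        using UNIV_2 by (intro ext) (metis UNIV_I insertE singletonD)
      then show "?c (f H) = H"
        by (simp add: f_def colour_subgraph_def cong: if_cong)
    qed
  next
    show "?c ` ?A \<subseteq> ?B"
      by (auto simp: labelled_graphs_def labels_colour_subgraph ec_graph_colour_subgraph)
  next
    show "f ` ?B \<subseteq> ?A"
    proof (rule image_subsetI)
      fix H :: "(nat, 2) ecgraph" assume "H \<in> labelled_graphs N"
      then have H: "ec_graph H" and N: "labels H = {..<N}" by (auto simp: labelled_graphs_def)
      let ?G = "ECGraph (verts H) (\<lambda>_. all_edges H) :: (nat, 1) ecgraph"
      have h: "halfedges ?G i = labels H" for i
        by (simp add: halfedges_def Union_all_edges)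
      have "card e = 2" if "e \<in> all_edges H" for e
        using that card_edge[OF H] by (auto simp: all_edges_def)
      then have "ec_graph ?G"
        using partition_on_all_edges[OF H] partition_verts[OF H] finite_labels[OF H]
        by (auto simp: ec_graph_def h disjoint_family_on_def)
      moreover have "labels ?G = {..<N}"
        using N h by (simp add: labels_mono)
      moreover have "edges H 1 \<in> Pow (all_edges ?G)"
        by (auto simp: all_edges_def)
      ultimately show "f H \<in> ?A"
        by (simp add: f_def labelled_graphs_def)
    qed
  qed
qed

section \<open>Invariance under relabelling\<close>

lemma euler_char_relabel:
  assumes G: "ec_graph G" and p: "inj_on p (labels G)"
  shows "euler_char (relabel p G) = euler_char G"
proof -
  have inj: "inj_on ((`) p) A" if "A \<subseteq> Pow (labels G)" for A
    using inj_on_image_Pow[OF p] that by (rule inj_on_subset)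
  have "all_edges (relabel p G) = (`) p ` all_edges G"
    by (auto simp: all_edges_def)
  moreover have "verts G \<subseteq> Pow (labels G)" "all_edges G \<subseteq> Pow (labels G)"
    using Union_verts[OF G] Union_all_edges[of G] by auto
  ultimately show ?thesis
    by (simp add: euler_char_def card_image inj)
qed

lemma deg_relabel:
  assumes G: "ec_graph G" and p: "inj_on p (labels G)" and v: "v \<in> verts G"
  shows "deg (relabel p G) (p ` v) = deg G v"
proof
  fix i
  have "p ` v \<inter> p ` halfedges G i = p ` (v \<inter> halfedges G i)"
    by (rule inj_on_image_Int[OF p vert_subset_labels[OF G v] halfedges_subset_labels, symmetric])
  moreover have "inj_on p (v \<inter> halfedges G i)"
    by (rule inj_on_subset[OF p]) (use vert_subset_labels[OF G v] in auto)
  ultimately show "deg (relabel p G) (p ` v) i = deg G v i"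
    by (simp add: deg_def card_image)
qed

lemma sub_deg_relabel:
  assumes G: "ec_graph G" and p: "inj_on p (labels G)" and v: "v \<in> verts G"
    and \<gamma>: "\<gamma> \<subseteq> all_edges G"
  shows "sub_deg ((`) p ` \<gamma>) (p ` v) = sub_deg \<gamma> v"
proof -
  have s: "\<Union>\<gamma> \<subseteq> labels G" using \<gamma> Union_all_edges[of G] by blast
  have "p ` v \<inter> \<Union>((`) p ` \<gamma>) = p ` (v \<inter> \<Union>\<gamma>)"
    using inj_on_image_Int[OF p vert_subset_labels[OF G v] s] by (simp add: image_Union)
  moreover have "inj_on p (v \<inter> \<Union>\<gamma>)"
    by (rule inj_on_subset[OF p]) (use vert_subset_labels[OF G v] in auto)
  ultimately show ?thesis
    by (simp add: sub_deg_def card_image)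
qed

lemma prod_verts_relabel:
  assumes G: "ec_graph G" and p: "inj_on p (labels G)"
  shows "(\<Prod>v\<in>verts (relabel p G). f v) = (\<Prod>v\<in>verts G. f (p ` v))"
proof -
  have "inj_on ((`) p) (verts G)"
    using inj_on_image_Pow[OF p] by (rule inj_on_subset) (use Union_verts[OF G] in auto)
  then show ?thesis by (simp add: prod.reindex)
qed

definition subgraph_sum :: "('h, 1) ecgraph \<Rightarrow> (param, 'a::field_char_0) mpol" where
  "subgraph_sum G = (\<Sum>\<gamma>\<in>Pow (all_edges G).
     \<Prod>v\<in>verts G. Var Par_J ^ sub_deg \<gamma> v * Var Par_h ^ (sub_deg \<gamma> v mod 2))"

lemma subgraph_sum_relabel:
  fixes G :: "('h, 1) ecgraph"
  assumes G: "ec_graph G" and p: "inj_on p (labels G)"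
  shows "(subgraph_sum (relabel p G) :: (param, 'a::field_char_0) mpol) = subgraph_sum G"
proof -
  have A: "all_edges (relabel p G) = (`) p ` all_edges G"
    by (auto simp: all_edges_def)
  have "inj_on ((`) p) (all_edges G)"
    using inj_on_image_Pow[OF p] by (rule inj_on_subset) (use Union_all_edges[of G] in auto)
  then have "inj_on ((`) ((`) p)) (Pow (all_edges G))"
    by (rule inj_on_image_Pow)
  then have "(subgraph_sum (relabel p G) :: (param, 'a) mpol) = (\<Sum>\<gamma>\<in>Pow (all_edges G). \<Prod>v\<in>verts (relabel p G).
      Var Par_J ^ sub_deg ((`) p ` \<gamma>) v * Var Par_h ^ (sub_deg ((`) p ` \<gamma>) v mod 2))"
    unfolding subgraph_sum_def A image_Pow_surj[OF refl, symmetric] by (simp add: sum.reindex)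
  also have "\<dots> = subgraph_sum G"
    unfolding subgraph_sum_def prod_verts_relabel[OF G p]
    by (intro sum.cong prod.cong) (simp_all add: sub_deg_relabel[OF G p])
  finally show ?thesis .
qed

lemma regular_relabel:
  assumes "ec_graph G" "inj_on p (labels G)"
  shows "regular k (relabel p G) \<longleftrightarrow> regular k G"
proof -
  have "regular k (relabel p G) \<longleftrightarrow> (\<forall>v\<in>verts G. deg (relabel p G) (p ` v) 1 = k)"
    by (simp only: regular_def verts_relabel ball_simps)
  also have "\<dots> \<longleftrightarrow> (\<forall>v\<in>verts G. deg G v 1 = k)"
    by (rule ball_cong[OF refl]) (simp only: deg_relabel[OF assms])
  finally show ?thesis
    by (simp only: regular_def)
qed

section \<open>Comparison of the two labelled sums\<close>

definition W_term :: "nat \<Rightarrow> nat \<Rightarrow> (nat, 2) ecgraph \<Rightarrow> (param, 'a::field_char_0) mpol" where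
  "W_term k n G = (if euler_char G = - int n then \<Prod>v\<in>verts G. Lam (W k) (deg G v) else 0)"

text \<open>As in \<open>W_term\<close>, the conditions on the graph sit inside the summand and the
  factor \<open>1 / |Aut|\<close> is left out. Both sums can then range over all graphs with a fixed
  number of half-edges, as \<open>sum_labelled_graphs\<close> requires.\<close>

definition regular_term :: "nat \<Rightarrow> nat \<Rightarrow> (nat, 1) ecgraph \<Rightarrow> (param, 'a::field_char_0) mpol" where
  "regular_term k n G = (if regular k G \<and> euler_char G = - int n then subgraph_sum G else 0)"

lemma relabel_invariant_W_term:
  "relabel_invariant (W_term k n :: _ \<Rightarrow> (param, 'a::field_char_0) mpol)"
  unfolding relabel_invariant_def
proof (intro allI impI)
  fix G :: "(nat, 2) ecgraph" and p :: "nat \<Rightarrow> nat"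
  assume "ec_graph G" "inj_on p (labels G)"
  note G = this
  have "(\<Prod>v\<in>verts (relabel p G). Lam (W k) (deg (relabel p G) v)) =
      (\<Prod>v\<in>verts G. Lam (W k) (deg G v) :: (param, 'a) mpol)"
    unfolding prod_verts_relabel[OF G]
    by (rule prod.cong[OF refl]) (simp only: deg_relabel[OF G])
  then show "W_term k n (relabel p G) = (W_term k n G :: (param, 'a) mpol)"
    by (simp only: W_term_def euler_char_relabel[OF G])
qed

lemma relabel_invariant_regular_term:
  "relabel_invariant (regular_term k n :: _ \<Rightarrow> (param, 'a::field_char_0) mpol)"
  unfolding relabel_invariant_def
proof (intro allI impI)
  fix G :: "(nat, 1) ecgraph" and p :: "nat \<Rightarrow> nat"
  assume "ec_graph G" "inj_on p (labels G)"
  then show "regular_term k n (relabel p G) = (regular_term k n G :: (param, 'a) mpol)"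
    by (simp only: regular_term_def euler_char_relabel regular_relabel subgraph_sum_relabel)
qed

text \<open>Splitting the edges into two colours splits the degree of a vertex without changing its
  total. Hence a single vertex of degree other than \<open>k\<close> makes the whole product
  vanish.\<close>

lemma W_term_colour_subgraph:
  assumes G: "ec_graph G" and \<gamma>: "\<gamma> \<subseteq> all_edges G"
  shows "(W_term k n (colour_subgraph G \<gamma>) :: (param, 'a::field_char_0) mpol) =
    (if regular k G \<and> euler_char G = - int n
     then \<Prod>v\<in>verts G. Var Par_J ^ sub_deg \<gamma> v * Var Par_h ^ (sub_deg \<gamma> v mod 2) else 0)"
proof -
  let ?H = "colour_subgraph G \<gamma>"
  have H: "ec_graph ?H" by (rule ec_graph_colour_subgraph[OF G \<gamma>])
  have L: "Lam (W k) (deg ?H v) =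
      (if deg G v 1 = k then Var Par_J ^ sub_deg \<gamma> v * Var Par_h ^ (sub_deg \<gamma> v mod 2) else 0 :: (param, 'a) mpol)"
    if "v \<in> verts G" for v
  proof -
    have "deg ?H v 1 + deg ?H v 2 = card v"
      using card_vert[OF H] that by simp
    moreover have "v \<inter> halfedges G 1 = v"
      using vert_subset_labels[OF G that] by (auto simp: labels_mono)
    ultimately have "deg ?H v 1 + deg ?H v 2 = deg G v 1"
      by (simp add: deg_def[of G])
    moreover have "deg ?H v 1 = sub_deg \<gamma> v"
      by (simp add: deg_def sub_deg_def halfedges_colour_subgraph)
    ultimately show ?thesis by (simp add: Lam_W)
  qed
  have e: "euler_char ?H = euler_char G"
    using \<gamma> by (simp add: euler_char_def all_edges_colour_subgraph)
  show ?thesis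
  proof (cases "regular k G")
    case True
    then show ?thesis by (simp add: W_term_def e L regular_def)
  next
    case False
    then obtain v where "v \<in> verts G" "deg G v 1 \<noteq> k" by (auto simp: regular_def)
    then have "(\<Prod>v\<in>verts G. Lam (W k) (deg ?H v) :: (param, 'a) mpol) = 0"
      using finite_verts[OF G] L[of v] by (intro prod_zero) auto
    then show ?thesis using False by (simp add: W_term_def e)
  qed
qed

text \<open>Group the 2-coloured graphs by their underlying monocoloured graph; each group runs over
  its subgraphs.\<close>

lemma sum_W_term:
  "(\<Sum>H\<in>labelled_graphs N. W_term k n H) =
   (\<Sum>G\<in>labelled_graphs N. regular_term k n G :: (param, 'a::field_char_0) mpol)"
proof -
  have "finite (all_edges G)" if "G \<in> labelled_graphs N" for G :: "(nat, 1) ecgraph"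
    using that finite_edges by (auto simp: labelled_graphs_def all_edges_mono)
  then have "(\<Sum>H\<in>labelled_graphs N. W_term k n H :: (param, 'a) mpol) =
      (\<Sum>G\<in>labelled_graphs N. \<Sum>\<gamma>\<in>Pow (all_edges G). W_term k n (colour_subgraph G \<gamma>))"
    by (subst sum.Sigma) (auto simp: finite_labelled_graphs case_prod_unfold
        simp flip: sum.reindex_bij_betw[OF colour_subgraph_bij])
  also have "\<dots> = (\<Sum>G\<in>labelled_graphs N. regular_term k n G)"
  proof (rule sum.cong[OF refl])
    fix G :: "(nat, 1) ecgraph" assume "G \<in> labelled_graphs N"
    then have "ec_graph G" by (simp add: labelled_graphs_def)
    then have "(\<Sum>\<gamma>\<in>Pow (all_edges G). W_term k n (colour_subgraph G \<gamma>) :: (param, 'a) mpol) =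
      (\<Sum>\<gamma>\<in>Pow (all_edges G). if regular k G \<and> euler_char G = - int n
        then \<Prod>v\<in>verts G. Var Par_J ^ sub_deg \<gamma> v * Var Par_h ^ (sub_deg \<gamma> v mod 2) else 0)"
      by (intro sum.cong refl W_term_colour_subgraph) auto
    then show "(\<Sum>\<gamma>\<in>Pow (all_edges G). W_term k n (colour_subgraph G \<gamma>)) = (regular_term k n G :: (param, 'a) mpol)"
      by (cases "regular k G \<and> euler_char G = - int n") (auto simp: regular_term_def subgraph_sum_def)
  qed
  finally show ?thesis .
qed

theorem theorem5p2:
  fixes k n :: nat
  assumes "k \<ge> 3"
  shows "(A_poly (W k) n :: (param, 'a::field_char_0) mpol) =
    (\<Sum>X \<in> {X \<in> iso_classes. regular k (rep X) \<and> euler_char (rep X) = - int n}.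
       Const (1 / of_nat (card (aut (rep X)))) *
       (\<Sum>\<gamma> \<in> Pow (all_edges (rep X)).
          \<Prod>v\<in>verts (rep X).
            Var Par_J ^ sub_deg \<gamma> v * Var Par_h ^ (sub_deg \<gamma> v mod 2)))"
proof -
  \<comment> \<open>The number of half-edges that \<open>card_labels_regular\<close> forces on every
    contributing graph.\<close>
  define N where "N = 2 * n * k div (k - 2)"
  \<comment> \<open>Both sides are extended to all classes with \<open>N\<close> half-edges. The set
    of these classes is finite, and the added terms vanish.\<close>
  have "(A_poly (W k) n :: (param, 'a) mpol) =
      (\<Sum>X \<in> {X \<in> iso_classes. card (labels (rep X)) = N}.
        Const (1 / of_nat (card (aut (rep X)))) * W_term k n (rep X))"
    unfolding A_poly_def
  proof (rule sum.mono_neutral_cong_left[OF finite_classes])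
    show "{X \<in> iso_classes. euler_char (rep X) = - int n \<and> graph_term (W k) (rep X) \<noteq> (0 :: (param, 'a) mpol)}
        \<subseteq> {X \<in> iso_classes. card (labels (rep X)) = N}"
    proof safe
      fix X :: "(nat, 2) ecgraph set"
      assume X: "X \<in> iso_classes" "euler_char (rep X) = - int n" and nz: "graph_term (W k) (rep X) \<noteq> (0 :: (param, 'a) mpol)"
      have G: "ec_graph (rep X)" by (rule ec_graph_rep[OF X(1)])
      have "card v = k" if v: "v \<in> verts (rep X)" for v
      proof (rule ccontr)
        assume "card v \<noteq> k"
        then have "Lam (W k) (deg (rep X) v) = (0 :: (param, 'a) mpol)"
          using card_vert[OF G v] by (simp add: Lam_W)
        then have "(\<Prod>v\<in>verts (rep X). Lam (W k) (deg (rep X) v)) = (0 :: (param, 'a) mpol)"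
          using finite_verts[OF G] v by (intro prod_zero) auto
        then show False using nz by (simp add: graph_term_def)
      qed
      then show "card (labels (rep X)) = N"
        unfolding N_def using card_labels_regular[OF G _ assms X(2)] by blast
    qed
  qed (auto simp: W_term_def graph_term_def)
  moreover have "(\<Sum>X \<in> {X \<in> iso_classes. regular k (rep X) \<and> euler_char (rep X) = - int n}.
       Const (1 / of_nat (card (aut (rep X)))) * (subgraph_sum (rep X) :: (param, 'a) mpol)) =
      (\<Sum>X \<in> {X \<in> iso_classes. card (labels (rep X)) = N}.
        Const (1 / of_nat (card (aut (rep X)))) * regular_term k n (rep X))"
  proof (rule sum.mono_neutral_cong_left[OF finite_classes])
    show "{X \<in> iso_classes. regular k (rep X) \<and> euler_char (rep X) = - int n}
        \<subseteq> {X \<in> iso_classes. card (labels (rep X)) = N}"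
    proof safe
      fix X :: "(nat, 1) ecgraph set"
      assume X: "X \<in> iso_classes" "regular k (rep X)" "euler_char (rep X) = - int n"
      have G: "ec_graph (rep X)" by (rule ec_graph_rep[OF X(1)])
      have "card v = k" if v: "v \<in> verts (rep X)" for v
      proof -
        have "v \<inter> halfedges (rep X) 1 = v"
          using vert_subset_labels[OF G v] by (auto simp: labels_mono)
        then show ?thesis using X(2) v by (auto simp: regular_def deg_def)
      qed
      then show "card (labels (rep X)) = N"
        unfolding N_def using card_labels_regular[OF G _ assms X(3)] by blast
    qed
  qed (auto simp: regular_term_def)
  \<comment> \<open>The factor \<open>N!\<close> common to both labelled sums cancels, since the
    constant polynomial \<open>N!\<close> has the inverse \<open>Const (1 / N!)\<close>.\<close>
  moreover have "of_nat (fact N) * x = of_nat (fact N) * y \<Longrightarrow> x = y" for x y :: "(param, 'a) mpol"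
  proof -
    have "Const (1 / of_nat (fact N)) * (of_nat (fact N) :: (param, 'a) mpol) = 1"
      unfolding Const_of_nat[symmetric] Const_mult[symmetric] by (simp add: Const_def)
    then have "z = Const (1 / of_nat (fact N)) * (of_nat (fact N) * z)" for z :: "(param, 'a) mpol"
      by (simp flip: mult.assoc)
    then show "of_nat (fact N) * x = of_nat (fact N) * y \<Longrightarrow> x = y"
      by metis
  qed
  ultimately show ?thesis
    using sum_W_term[of k n N, where 'a = 'a]
    unfolding sum_labelled_graphs[OF relabel_invariant_W_term]
      sum_labelled_graphs[OF relabel_invariant_regular_term]
    by (simp only: subgraph_sum_def)
qed

end
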